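(* Among the $112$ Leech roots in ${\rm II}_{1,25}$ orthogonal to $R$, there exist two sets ${\cal A}$ and ${\cal B}$, each of which consists of $16$ Leech roots, such that each member of one set meets exactly $10$ members of the other set.
   Context: Let $\Omega={\bf P}^1({\bf F}_{23})$ and fix a Steiner system $S(5,8,24)$ on $\Omega$ (a set of $8$-element subsets of $\Omega$, called octads, such that any $5$-element subset of $\Omega$ lies in a unique octad). Let $\{e_i\}_{i\in\Omega}$ be the standard basis of ${\bf R}^{24}={\bf R}^{\Omega}$, equipped with the inner product $\langle x,y\rangle=-\frac{x\cdot y}{8}$, and $\nu_A=\sum_{i\in A}e_i$ for $A\subset\Omega$ ($\nu_i=\nu_{\{i\}}$). The Leech lattice $\Lambda$ (even, negative definite, unimodular, rank $24$, no vectors of norm $-2$) is the lattice generated by $\nu_\Omega-4\nu_\infty$ and all $2\nu_K$, $K$ an octad. ${\rm II}_{1,25}=U\oplus\Lambda$ is the even unimodular lattice of signature $(1,25)$, $U$ the hyperbolic plane; its vectors are written $(m,n,\lambda)$, $m,n\in{\bf Z}$, $\lambda\in\Lambda$, with norm $2mn+\langle\lambda,\lambda\rangle$. A root is a vector $r$ with $\langle r,r\rangle=-2$. Let $\rho=(1,0,0)$ (Weyl vector). A Leech root is a root $r$ with $\langle r,\rho\rangle=1$. Two Leech roots $r,r'$ meet if $\langle r,r'\rangle=1$. Let $X=4\nu_\infty+\nu_\Omega$, $Z=0$, $P=4\nu_\infty+4\nu_0$, $Q=\nu_\Omega-4\nu_1$, and let $x=(2,1,X)$, $z=(-1,1,0)$,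 $p=(1,1,P)$, $q=(1,1,Q)$ be the corresponding Leech roots. They generate a primitive root sublattice $R\cong A_2\oplus A_2$ (negative definite) of ${\rm II}_{1,25}$. There are exactly $112$ Leech roots orthogonal to $R$. *)

theory Defs
  imports
    "HOL-Analysis.Analysis"
    "HOL-Library.Numeral_Type"
    "HOL-Computational_Algebra.Group_Closure"
begin

text \<open>
  The numeral type \<open>23\<close> is the ring of integers modulo 23, i.e. the field with 23 elements.
  The projective line over it is the field (via \<^const>\<open>Some\<close>) together with
  the point at infinity, \<^const>\<open>None\<close>.
\<close>

type_synonym proj_line = "23 option"

abbreviation pt_infty :: proj_line ("\<infinity>\<^sub>P") where "\<infinity>\<^sub>P \<equiv> None"
abbreviation pt_zero :: proj_line ("0\<^sub>P") where "0\<^sub>P \<equiv> Some 0"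
abbreviation pt_one :: proj_line ("1\<^sub>P") where "1\<^sub>P \<equiv> Some 1"

definition steiner_system :: "nat \<Rightarrow> nat \<Rightarrow> nat \<Rightarrow> 'a set \<Rightarrow> 'a set set \<Rightarrow> bool" where
  "steiner_system t k n V \<B> \<longleftrightarrow>
     finite V \<and> card V = n \<and>
     (\<forall>K\<in>\<B>. K \<subseteq> V \<and> card K = k) \<and>
     (\<forall>T. T \<subseteq> V \<and> card T = t \<longrightarrow> (\<exists>!K. K \<in> \<B> \<and> T \<subseteq> K))"

definition nu :: "proj_line set \<Rightarrow> real ^ proj_line" ("\<nu>") where
  "\<nu> A = (\<Sum>i\<in>A. axis i 1)"

definition leech_form :: "real ^ proj_line \<Rightarrow> real ^ proj_line \<Rightarrow> real" where
  "leech_form x y = - (x \<bullet> y) / 8"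

definition leech_lattice :: "proj_line set set \<Rightarrow> (real ^ proj_line) set" where
  "leech_lattice octads =
     group_closure (insert (\<nu> UNIV - 4 *\<^sub>R \<nu> {\<infinity>\<^sub>P}) ((\<lambda>K. 2 *\<^sub>R \<nu> K) ` octads))"

text \<open>
  The lattice \<open>II\<^bsub>1,25\<^esub> = U \<oplus> \<Lambda>\<close> lives in the ambient group of triples
  \<open>(m, n, \<lambda>)\<close> with \<open>\<lambda>\<close> an arbitrary real vector. The bilinear form is the polarization of
  the norm \<open>2mn + \<langle>\<lambda>, \<lambda>\<rangle>\<close>.
\<close>

type_synonym vec26 = "int \<times> int \<times> (real ^ proj_line)"

definition II_1_25 :: "proj_line set set \<Rightarrow> vec26 set" where
  "II_1_25 octads = UNIV \<times> UNIV \<times> leech_lattice octads"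

fun II_form :: "vec26 \<Rightarrow> vec26 \<Rightarrow> real" where
  "II_form (m, n, l) (m', n', l') = of_int (m * n' + m' * n) + leech_form l l'"

definition weyl_vector :: vec26 where
  "weyl_vector = (1, 0, 0)"

definition roots :: "proj_line set set \<Rightarrow> vec26 set" where
  "roots octads = {r \<in> II_1_25 octads. II_form r r = -2}"

definition leech_roots :: "proj_line set set \<Rightarrow> vec26 set" where
  "leech_roots octads = {r \<in> roots octads. II_form r weyl_vector = 1}"

definition meets :: "vec26 \<Rightarrow> vec26 \<Rightarrow> bool" where
  "meets r r' \<longleftrightarrow> II_form r r' = 1"

definition root_x :: vec26 where
  "root_x = (2, 1, 4 *\<^sub>R \<nu> {\<infinity>\<^sub>P} + \<nu> UNIV)"

definition root_z :: vec26 where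
  "root_z = (-1, 1, 0)"

definition root_p :: vec26 where
  "root_p = (1, 1, 4 *\<^sub>R \<nu> {\<infinity>\<^sub>P} + 4 *\<^sub>R \<nu> {0\<^sub>P})"

definition root_q :: vec26 where
  "root_q = (1, 1, \<nu> UNIV - 4 *\<^sub>R \<nu> {1\<^sub>P})"

definition lattice_R :: "vec26 set" where
  "lattice_R = group_closure {root_x, root_z, root_p, root_q}"

definition leech_roots_orth_R :: "proj_line set set \<Rightarrow> vec26 set" where
  "leech_roots_orth_R octads = {r \<in> leech_roots octads. \<forall>s\<in>lattice_R. II_form r s = 0}"

end

theory Submission
  imports Defs
begin

text \<open>
  Write \<open>\<lambda>\<close> for the component in \<open>\<Lambda>\<close> of a Leech root; it determines the root, and orthogonality to
  \<open>x\<close>, \<open>z\<close>, \<open>p\<close>, \<open>q\<close> says that \<open>\<lambda>\<close> is a minimal vector at minimal distance from \<open>X\<close>, \<open>P\<close> and \<open>Q\<close>.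
  Two families of such vectors are easy to see: \<open>2\<nu>\<^sub>K\<close> for an octad \<open>K\<close> containing \<open>\<infinity>\<close> and \<open>0\<close> but not
  \<open>1\<close>, and \<open>\<nu>\<^sub>\<Omega> - 2\<nu>\<^sub>L + 4\<nu>\<^sub>\<infinity>\<close> for an octad \<open>L\<close> containing \<open>\<infinity>\<close> and \<open>1\<close> but not \<open>0\<close>
  (\<open>octad_root_orth_R\<close>, \<open>odd_octad_root_orth_R\<close>).  The roots belonging to \<open>K\<close> and \<open>L\<close> have inner
  product \<open>|K \<inter> L| / 2 - 1\<close>, so they meet exactly when \<open>|K \<inter> L| = 4\<close>.

  The set \<open>\<A>\<close> is the part of the first family with \<open>c \<in> K\<close>, and \<open>\<B>\<close> the part of the second
  with \<open>c \<in> L\<close>, where \<open>c\<close> is any fourth point.  There are 21 octads through three points and 5 through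
  four, so both sets have \<open>21 - 5 = 16\<close> elements.  Fix \<open>K\<close>.  An octad \<open>L\<close> of the second family that meets \<open>K\<close> in
  four points is spanned by \<open>1\<close> and these four points, which are \<open>\<infinity>\<close>, \<open>c\<close> and two of the five other points of
  \<open>K\<close> distinct from \<open>0\<close>; conversely any such choice gives an admissible \<open>L\<close>,
  which avoids \<open>0\<close> because it cannot share five points with \<open>K\<close>.  Hence \<open>K\<close> has
  \<open>5 choose 2 = 10\<close> partners (\<open>steiner_card_blocks_meeting_block\<close>), and the situation is symmetric in
  the two families.

  The second family lies in the lattice because \<open>8\<nu>\<^sub>\<infinity>\<close> does.  This, too, comes from counting
  blocks: sums of the generators \<open>2\<nu>\<^sub>K\<close> over all octads through a given set are known explicitly
  (\<open>eight_nu_infty_in_leech_lattice\<close>).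
\<close>

section \<open>Counting blocks of a Steiner system\<close>

lemma card_subsets_between:
  assumes "finite K" "S \<subseteq> K" "card S \<le> t"
  shows "card {T. S \<subseteq> T \<and> T \<subseteq> K \<and> card T = t} = (card K - card S) choose (t - card S)"
proof -
  have fS: "finite S" using assms finite_subset by blast
  have "bij_betw (\<lambda>A. A \<union> S) {A. A \<subseteq> K - S \<and> card A = t - card S}
          {T. S \<subseteq> T \<and> T \<subseteq> K \<and> card T = t}"
  proof (rule bij_betw_byWitness[where f' = "\<lambda>T. T - S"])
    show "(\<lambda>A. A \<union> S) ` {A. A \<subseteq> K - S \<and> card A = t - card S}
            \<subseteq> {T. S \<subseteq> T \<and> T \<subseteq> K \<and> card T = t}"
    proof clarsimp
      fix A assume A: "A \<subseteq> K - S" "card A = t - card S"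
      have "card (A \<union> S) = card A + card S"
        using A fS assms(1) by (intro card_Un_disjoint) (auto intro: finite_subset)
      then show "A \<subseteq> K \<and> S \<subseteq> K \<and> card (A \<union> S) = t" using A assms by auto
    qed
    show "(\<lambda>T. T - S) ` {T. S \<subseteq> T \<and> T \<subseteq> K \<and> card T = t}
            \<subseteq> {A. A \<subseteq> K - S \<and> card A = t - card S}"
      using fS by (auto simp: card_Diff_subset)
  qed auto
  then have "card {T. S \<subseteq> T \<and> T \<subseteq> K \<and> card T = t} = card {A. A \<subseteq> K - S \<and> card A = t - card S}"
    by (simp add: bij_betw_same_card)
  also have "\<dots> = card (K - S) choose (t - card S)"
    using assms by (intro n_subsets) auto
  finally show ?thesis
    using assms fS by (simp add: card_Diff_subset)
qed

context
  fixes t k n :: nat and V :: "'a set" and \<B> :: "'a set set"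
  assumes steiner: "steiner_system t k n V \<B>"
begin

lemma steiner_finite: "finite V" "finite \<B>" "K \<in> \<B> \<Longrightarrow> finite K"
proof -
  show V: "finite V" using steiner by (simp add: steiner_system_def)
  have "\<B> \<subseteq> Pow V" using steiner by (auto simp: steiner_system_def)
  then show "finite \<B>" using V finite_subset by blast
  show "K \<in> \<B> \<Longrightarrow> finite K" using \<open>\<B> \<subseteq> Pow V\<close> V finite_subset by blast
qed

lemma steiner_card: "card V = n" "K \<in> \<B> \<Longrightarrow> card K = k" "K \<in> \<B> \<Longrightarrow> K \<subseteq> V"
  using steiner by (auto simp: steiner_system_def)

lemma steiner_block_unique:
  assumes "K \<in> \<B>" "L \<in> \<B>" "T \<subseteq> K" "T \<subseteq> L" "card T = t"
  shows "K = L"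
proof -
  have "T \<subseteq> V" using assms steiner_card(3) by blast
  then have "\<exists>!K. K \<in> \<B> \<and> T \<subseteq> K" using steiner assms(5) by (simp add: steiner_system_def)
  then show ?thesis using assms by blast
qed

lemma steiner_block_exists:
  assumes "T \<subseteq> V" "card T = t"
  obtains K where "K \<in> \<B>" "T \<subseteq> K"
proof -
  have "\<exists>!K. K \<in> \<B> \<and> T \<subseteq> K" using steiner assms by (simp add: steiner_system_def)
  then show ?thesis using that by blast
qed

text \<open>
  Double counting: each \<open>t\<close>-set between \<open>S\<close> and \<open>V\<close> lies in exactly one block, so these
  \<open>t\<close>-sets are partitioned according to the block (necessarily containing \<open>S\<close>) that they span.
\<close>

lemma steiner_card_blocks_through:
  assumes "S \<subseteq> V" "card S \<le> t"
  shows "card {K \<in> \<B>. S \<subseteq> K} * ((k - card S) choose (t - card S)) = (n - card S) choose (t - card S)"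
proof -
  let ?P = "\<lambda>K. {T. S \<subseteq> T \<and> T \<subseteq> K \<and> card T = t}"
  have eq: "?P V = (\<Union>K \<in> {K \<in> \<B>. S \<subseteq> K}. ?P K)" (is "_ = ?U")
  proof
    show "?P V \<subseteq> ?U"
    proof
      fix T assume T: "T \<in> ?P V"
      then obtain K where "K \<in> \<B>" "T \<subseteq> K" using steiner_block_exists[of T] by blast
      then show "T \<in> ?U" using T by blast
    qed
    show "?U \<subseteq> ?P V" using steiner_card(3) by blast
  qed
  have "card (?P V) = (\<Sum>K \<in> {K \<in> \<B>. S \<subseteq> K}. card (?P K))"
    unfolding eq
  proof (rule card_UN_disjoint)
    show "\<forall>i\<in>{K \<in> \<B>. S \<subseteq> K}. \<forall>j\<in>{K \<in> \<B>. S \<subseteq> K}. i \<noteq> j \<longrightarrow> ?P i \<inter> ?P j = {}"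
    proof (intro ballI impI)
      fix K L assume KL: "K \<in> {K \<in> \<B>. S \<subseteq> K}" "L \<in> {K \<in> \<B>. S \<subseteq> K}" "K \<noteq> L"
      then show "?P K \<inter> ?P L = {}" using steiner_block_unique[of K L] by blast
    qed
    show "\<forall>i\<in>{K \<in> \<B>. S \<subseteq> K}. finite (?P i)"
      using steiner_finite(3) by simp
  qed (use steiner_finite in auto)
  also have "\<dots> = (\<Sum>K \<in> {K \<in> \<B>. S \<subseteq> K}. (k - card S) choose (t - card S))"
    using assms steiner_finite steiner_card by (intro sum.cong) (auto simp: card_subsets_between)
  finally show ?thesis
    using assms steiner_finite steiner_card by (simp add: card_subsets_between)
qed

lemma steiner_card_blocks_through_avoiding:
  assumes "c \<notin> S"
  shows "card {K \<in> \<B>. S \<subseteq> K \<and> c \<notin> K} = card {K \<in> \<B>. S \<subseteq> K} - card {K \<in> \<B>. insert c S \<subseteq> K}"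
proof -
  have "{K \<in> \<B>. S \<subseteq> K \<and> c \<notin> K} = {K \<in> \<B>. S \<subseteq> K} - {K \<in> \<B>. insert c S \<subseteq> K}" by auto
  moreover have "{K \<in> \<B>. insert c S \<subseteq> K} \<subseteq> {K \<in> \<B>. S \<subseteq> K}" by auto
  ultimately show ?thesis using steiner_finite(2) by (simp add: card_Diff_subset)
qed

text \<open>
  A block \<open>L\<close> through \<open>v \<notin> K\<close> with \<open>|K \<inter> L| = t - 1\<close> is spanned by \<open>v\<close> and \<open>K \<inter> L\<close>.  Conversely
  the block spanned by \<open>v\<close> and a \<open>(t - 1)\<close>-subset \<open>M\<close> of \<open>K\<close> meets \<open>K\<close> in \<open>M\<close> only, since one more
  common point would force it to be \<open>K\<close>.  So \<open>L \<mapsto> K \<inter> L\<close> turns the count of blocks into a count of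
  subsets of \<open>K\<close>.
\<close>

lemma steiner_card_blocks_meeting_block:
  assumes K: "K \<in> \<B>" and D: "D \<subseteq> K" and u: "u \<in> K" "u \<notin> D" and v: "v \<in> V" "v \<notin> K"
    and t: "card D < t"
  shows "card {L \<in> \<B>. insert v D \<subseteq> L \<and> u \<notin> L \<and> card (K \<inter> L) = t - 1} =
    (k - 1 - card D) choose (t - 1 - card D)"
proof -
  let ?Ls = "{L \<in> \<B>. insert v D \<subseteq> L \<and> u \<notin> L \<and> card (K \<inter> L) = t - 1}"
  let ?Ms = "{M. D \<subseteq> M \<and> M \<subseteq> K - {u} \<and> card M = t - 1}"
  have fK: "finite K" using K steiner_finite by blast
  have "bij_betw (\<lambda>L. K \<inter> L) ?Ls ?Ms"
  proof (rule bij_betwI')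
    fix L L' assume L: "L \<in> ?Ls" and L': "L' \<in> ?Ls"
    show "(K \<inter> L = K \<inter> L') = (L = L')"
    proof
      assume eq: "K \<inter> L = K \<inter> L'"
      have "card (insert v (K \<inter> L)) = t" using L v(2) fK t by simp
      moreover have "insert v (K \<inter> L) \<subseteq> L" "insert v (K \<inter> L) \<subseteq> L'" using L L' eq by auto
      ultimately show "L = L'" using L L' steiner_block_unique by blast
    qed simp
  next
    fix L assume "L \<in> ?Ls"
    then show "K \<inter> L \<in> ?Ms" using D by auto
  next
    fix M assume M: "M \<in> ?Ms"
    have fM: "finite M" using M fK finite_subset by blast
    have "card (insert v M) = t" using M v(2) fM t by (simp add: card_insert_if) blast
    moreover have "insert v M \<subseteq> V" using M v K steiner_card(3) by blast
    ultimately obtain L where L: "L \<in> \<B>" "insert v M \<subseteq> L" using steiner_block_exists by blast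
    \<comment> \<open>otherwise \<open>L\<close> and \<open>K\<close> would share the \<open>t\<close>-set \<open>insert w M\<close>\<close>
    have "w \<notin> L" if w: "w \<in> K" "w \<notin> M" for w
    proof
      assume "w \<in> L"
      moreover have "card (insert w M) = t" using M w fM t by simp
      ultimately have "K = L" using K L M w steiner_block_unique[of K L "insert w M"] by blast
      then show False using L v by blast
    qed
    then have "K \<inter> L = M" "u \<notin> L" using M L u by blast+
    then show "\<exists>L\<in>?Ls. M = K \<inter> L" using L M by blast
  qed
  then have "card ?Ls = card ?Ms" by (rule bij_betw_same_card)
  also have "\<dots> = (card (K - {u}) - card D) choose (t - 1 - card D)"
    using D u fK t by (intro card_subsets_between) auto
  finally show ?thesis using K u fK steiner_card(2) by simp
qed

end

section \<open>The Leech lattice of an octad system\<close>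

lemma nu_component: "\<nu> A $ i = (if i \<in> A then 1 else 0)"
  by (simp add: nu_def axis_def sum.If_cases if_distrib cong: if_cong)

lemma inner_nu: "\<nu> A \<bullet> \<nu> B = card (A \<inter> B)"
proof -
  have "\<nu> A \<bullet> \<nu> B = (\<Sum>i\<in>UNIV. if i \<in> A \<inter> B then 1 else 0)"
    unfolding inner_vec_def by (intro sum.cong) (auto simp: nu_component)
  then show ?thesis by (simp add: sum.If_cases Int_def)
qed

lemma inj_nu: "inj \<nu>"
  by (intro injI set_eqI) (metis nu_component zero_neq_one)

lemma group_closure_scaleR_of_int:
  fixes S :: "'a::real_vector set"
  assumes "x \<in> group_closure S"
  shows "of_int m *\<^sub>R x \<in> group_closure S"
proof -
  have nat: "of_nat m *\<^sub>R x \<in> group_closure S" for m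
    by (induction m) (use assms in \<open>auto simp: algebra_simps group_closure_add\<close>)
  show ?thesis
    by (cases m rule: int_cases2) (use nat in \<open>simp_all\<close>)
qed

lemma group_closure_sum:
  assumes "\<And>i. i \<in> I \<Longrightarrow> f i \<in> group_closure S"
  shows "sum f I \<in> group_closure S"
  using assms by (induction I rule: infinite_finite_induct) (auto intro: group_closure_add)

lemma two_nu_octad_in_leech_lattice: "K \<in> octads \<Longrightarrow> 2 *\<^sub>R \<nu> K \<in> leech_lattice octads"
  by (simp add: leech_lattice_def group_closure.base)

context
  fixes octads :: "proj_line set set"
  assumes octads: "steiner_system 5 8 24 UNIV octads"
begin

lemma card_octads_through:
  "card S = 1 \<Longrightarrow> card {K \<in> octads. S \<subseteq> K} = 253"
  "card S = 3 \<Longrightarrow> card {K \<in> octads. S \<subseteq> K} = 21"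
  "card S = 4 \<Longrightarrow> card {K \<in> octads. S \<subseteq> K} = 5"
  "card S = 5 \<Longrightarrow> card {K \<in> octads. S \<subseteq> K} = 1"
  using steiner_card_blocks_through[OF octads, of S] by (simp_all add: binomial_fact' fact_numeral)

lemma card_octads_through_avoiding:
  assumes "card S = 3" "c \<notin> S"
  shows "card {K \<in> octads. S \<subseteq> K \<and> c \<notin> K} = 16"
  using assms card_octads_through[of S] card_octads_through[of "insert c S"]
  by (simp add: steiner_card_blocks_through_avoiding[OF octads])

text \<open>
  The coordinate at \<open>j\<close> counts the octads containing \<open>insert j S\<close>, which for \<open>j \<notin> S\<close> depends only
  on the size of \<open>S\<close>.
\<close>

lemma sum_nu_octads_through:
  assumes "\<And>j. j \<notin> S \<Longrightarrow> card {K \<in> octads. insert j S \<subseteq> K} = b"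
  shows "(\<Sum>K \<in> {K \<in> octads. S \<subseteq> K}. \<nu> K) =
    (real (card {K \<in> octads. S \<subseteq> K}) - real b) *\<^sub>R \<nu> S + real b *\<^sub>R \<nu> UNIV"
proof (subst vec_eq_iff, intro allI)
  fix j
  have "(\<Sum>K \<in> {K \<in> octads. S \<subseteq> K}. \<nu> K) $ j = card {K \<in> octads. insert j S \<subseteq> K}"
    using steiner_finite(2)[OF octads]
    by (simp add: nu_component sum.If_cases Int_def conj_ac)
  also have "\<dots> = ((real (card {K \<in> octads. S \<subseteq> K}) - real b) *\<^sub>R \<nu> S + real b *\<^sub>R \<nu> UNIV) $ j"
    using assms by (cases "j \<in> S") (auto simp: nu_component insert_absorb)
  finally show "(\<Sum>K \<in> {K \<in> octads. S \<subseteq> K}. \<nu> K) $ j = \<dots>" .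
qed

text \<open>
  For \<open>|S| = 0, 3, 4\<close> the sum of the generators \<open>2\<nu>\<^sub>K\<close> over the octads through \<open>S\<close> is
  \<open>506\<nu>\<^sub>\<Omega>\<close>, \<open>32\<nu>\<^sub>S + 10\<nu>\<^sub>\<Omega>\<close> and \<open>8\<nu>\<^sub>S + 2\<nu>\<^sub>\<Omega>\<close>.  Comparing a triple \<open>T\<close> with \<open>T \<union> {\<infinity>}\<close>
  eliminates \<open>\<nu>\<^sub>T\<close>, and then \<open>\<nu>\<^sub>\<Omega> - 4\<nu>\<^sub>\<infinity>\<close> eliminates \<open>\<nu>\<^sub>\<Omega>\<close>, which leaves \<open>24\<nu>\<^sub>\<infinity>\<close>; the sum over
  all octads likewise gives \<open>2024\<nu>\<^sub>\<infinity>\<close>.  Finally \<open>2024 - 84 \<cdot> 24 = 8\<close>.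
\<close>

lemma eight_nu_infty_in_leech_lattice: "8 *\<^sub>R \<nu> {\<infinity>\<^sub>P} \<in> leech_lattice octads"
proof -
  define T :: "proj_line set" where "T = {0\<^sub>P, 1\<^sub>P, Some 2}"
  have cT: "card T = 3" "\<infinity>\<^sub>P \<notin> T" by (auto simp: T_def)
  let ?\<sigma> = "\<lambda>S. 2 *\<^sub>R (\<Sum>K \<in> {K \<in> octads. S \<subseteq> K}. \<nu> K)"
  let ?a = "\<nu> UNIV - 4 *\<^sub>R \<nu> {\<infinity>\<^sub>P}"
  have \<sigma>: "?\<sigma> S \<in> leech_lattice octads" for S
    unfolding scaleR_sum_right leech_lattice_def
    by (intro group_closure_sum group_closure.base) auto
  have a: "?a \<in> leech_lattice octads"
    by (simp add: leech_lattice_def group_closure.base)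
  have s0: "?\<sigma> {} = 506 *\<^sub>R \<nu> UNIV"
    by (subst sum_nu_octads_through[where b = 253])
      (use card_octads_through(1)[of "{j}" for j] in \<open>auto simp: nu_def\<close>)
  have s3: "?\<sigma> T = 32 *\<^sub>R \<nu> T + 10 *\<^sub>R \<nu> UNIV"
    using cT
    by (subst sum_nu_octads_through[where b = 5])
      (auto simp: card_octads_through algebra_simps simp del: insert_subset)
  have s4: "?\<sigma> (insert \<infinity>\<^sub>P T) = 8 *\<^sub>R \<nu> T + 8 *\<^sub>R \<nu> {\<infinity>\<^sub>P} + 2 *\<^sub>R \<nu> UNIV"
  proof -
    have "\<nu> (insert \<infinity>\<^sub>P T) = \<nu> T + \<nu> {\<infinity>\<^sub>P}" using cT by (simp add: nu_def)
    then show ?thesis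
      using cT
      by (subst sum_nu_octads_through[where b = 1])
        (auto simp: card_octads_through algebra_simps simp del: insert_subset)
  qed
  (* the coefficients are those of (?\<sigma> {} - 506 a) - 84 (4 ?\<sigma> (insert \<infinity>\<^sub>P T) - ?\<sigma> T + 2 a),
     where the brackets are 2024 and 24 times \<nu> {\<infinity>\<^sub>P} and a is ?a *)
  have "8 *\<^sub>R \<nu> {\<infinity>\<^sub>P} = of_int 1 *\<^sub>R ?\<sigma> {} + of_int (-674) *\<^sub>R ?a
      + of_int (-336) *\<^sub>R ?\<sigma> (insert \<infinity>\<^sub>P T) + of_int 84 *\<^sub>R ?\<sigma> T"
    unfolding s0 s3 s4 by (simp add: vec_eq_iff algebra_simps)
  also have "\<dots> \<in> leech_lattice octads"
    using \<sigma> a unfolding leech_lattice_def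
    by (intro group_closure_add group_closure_scaleR_of_int)
  finally show ?thesis .
qed

end

section \<open>Leech roots orthogonal to R\<close>

lemma II_form_diff_right: "II_form r (s - t) = II_form r s - II_form r t"
  by (cases r; cases s; cases t)
    (simp add: leech_form_def inner_diff_right algebra_simps diff_divide_distrib)

text \<open>Orthogonality to \<open>R\<close> can be checked on the four generators.\<close>

lemma II_form_orth_group_closure:
  assumes "\<And>s. s \<in> S \<Longrightarrow> II_form r s = 0" "s \<in> group_closure S"
  shows "II_form r s = 0"
  using assms(2)
proof (induction rule: group_closure.induct)
  case (base s)
  have "II_form r 0 = 0" using II_form_diff_right[of r 0 0] by simp
  then show ?case using base assms(1)[of s] by blast
next
  case (diff s t)
  then show ?case by (simp add: II_form_diff_right)
qed

lemma leech_roots_orth_R_I: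
  assumes "r \<in> leech_roots octads"
    and "\<And>s. s \<in> {root_x, root_z, root_p, root_q} \<Longrightarrow> II_form r s = 0"
  shows "r \<in> leech_roots_orth_R octads"
  using assms(1) II_form_orth_group_closure[OF assms(2)]
  unfolding leech_roots_orth_R_def lattice_R_def by blast

lemma meets_commute: "meets r s \<longleftrightarrow> meets s r"
  by (cases r; cases s) (simp add: meets_def leech_form_def inner_commute algebra_simps)

definition octad_root :: "proj_line set \<Rightarrow> vec26" where
  "octad_root K = (1, 1, 2 *\<^sub>R \<nu> K)"

text \<open>
  The vector is \<open>\<nu>\<^sub>\<Omega> - 4\<nu>\<^sub>\<infinity>\<close> with its signs changed on \<open>K\<close> whenever \<open>\<infinity> \<in> K\<close>: it is \<open>3\<close> at
  \<open>\<infinity>\<close>, \<open>-1\<close> on the rest of \<open>K\<close> and \<open>1\<close> elsewhere.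
\<close>

definition odd_octad_root :: "proj_line set \<Rightarrow> vec26" where
  "odd_octad_root K = (1, 1, \<nu> UNIV - 2 *\<^sub>R \<nu> K + 4 *\<^sub>R \<nu> {\<infinity>\<^sub>P})"

lemma inj_octad_root: "inj octad_root"
  using inj_nu by (auto simp: octad_root_def inj_def)

lemma inj_odd_octad_root: "inj odd_octad_root"
  using inj_nu by (auto simp: odd_octad_root_def inj_def)

lemmas inner_nu_simps = inner_nu inner_add_left inner_add_right inner_diff_left inner_diff_right

context
  fixes octads :: "proj_line set set"
  assumes octads: "steiner_system 5 8 24 UNIV octads"
begin

lemma octad_root_orth_R:
  assumes K: "K \<in> octads" "\<infinity>\<^sub>P \<in> K" "0\<^sub>P \<in> K" "1\<^sub>P \<notin> K"
  shows "octad_root K \<in> leech_roots_orth_R octads"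
proof -
  have card: "card K = 8" "card (UNIV :: proj_line set) = 24"
    using K steiner_card[OF octads] by auto
  have "octad_root K \<in> leech_roots octads"
    using two_nu_octad_in_leech_lattice[OF K(1)] card
    by (simp add: leech_roots_def roots_def II_1_25_def octad_root_def weyl_vector_def
        leech_form_def inner_nu)
  moreover have "II_form (octad_root K) s = 0" if "s \<in> {root_x, root_z, root_p, root_q}" for s
    using that K card
    by (auto simp: octad_root_def root_x_def root_z_def root_p_def root_q_def
        leech_form_def inner_nu_simps)
  ultimately show ?thesis by (rule leech_roots_orth_R_I)
qed

lemma odd_octad_root_orth_R:
  assumes K: "K \<in> octads" "\<infinity>\<^sub>P \<in> K" "1\<^sub>P \<in> K" "0\<^sub>P \<notin> K"
  shows "odd_octad_root K \<in> leech_roots_orth_R octads"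
proof -
  have card: "card K = 8" "card (UNIV :: proj_line set) = 24"
    using K steiner_card[OF octads] by auto
  have a: "\<nu> UNIV - 4 *\<^sub>R \<nu> {\<infinity>\<^sub>P} \<in> leech_lattice octads"
    by (simp add: leech_lattice_def group_closure.base)
  have "\<nu> UNIV - 2 *\<^sub>R \<nu> K + 4 *\<^sub>R \<nu> {\<infinity>\<^sub>P} =
      (\<nu> UNIV - 4 *\<^sub>R \<nu> {\<infinity>\<^sub>P}) - 2 *\<^sub>R \<nu> K + 8 *\<^sub>R \<nu> {\<infinity>\<^sub>P}"
    by (simp add: vec_eq_iff)
  also have "\<dots> \<in> leech_lattice octads"
    using a two_nu_octad_in_leech_lattice[OF K(1)] eight_nu_infty_in_leech_lattice[OF octads]
    unfolding leech_lattice_def by (rule group_closure_add[OF group_closure.diff])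
  finally have "odd_octad_root K \<in> leech_roots octads"
    using card K
    by (simp add: leech_roots_def roots_def II_1_25_def odd_octad_root_def weyl_vector_def
        leech_form_def inner_nu_simps)
  moreover have "II_form (odd_octad_root K) s = 0" if "s \<in> {root_x, root_z, root_p, root_q}" for s
    using that K card
    by (auto simp: odd_octad_root_def root_x_def root_z_def root_p_def root_q_def
        leech_form_def inner_nu_simps)
  ultimately show ?thesis by (rule leech_roots_orth_R_I)
qed

lemma meets_octad_root_odd_octad_root:
  assumes "K \<in> octads" "\<infinity>\<^sub>P \<in> K"
  shows "meets (octad_root K) (odd_octad_root L) \<longleftrightarrow> card (K \<inter> L) = 4"
proof -
  have "card K = 8" using assms steiner_card[OF octads] by auto
  then have "II_form (octad_root K) (odd_octad_root L) = real (card (K \<inter> L)) / 2 - 1"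
    using assms(2) by (simp add: octad_root_def odd_octad_root_def leech_form_def inner_nu_simps field_simps)
  then show ?thesis by (simp add: meets_def)
qed

end

theorem proposition2p9:
  fixes octads :: "proj_line set set"
  assumes "steiner_system 5 8 24 UNIV octads"
  shows "\<exists>\<A> \<B>. \<A> \<subseteq> leech_roots_orth_R octads \<and> \<B> \<subseteq> leech_roots_orth_R octads \<and>
           \<A> \<noteq> \<B> \<and> card \<A> = 16 \<and> card \<B> = 16 \<and>
           (\<forall>a\<in>\<A>. card {b \<in> \<B>. meets a b} = 10) \<and>
           (\<forall>b\<in>\<B>. card {a \<in> \<A>. meets b a} = 10)"
proof -
  (* any point other than infinity, 0 and 1 could serve as the fourth point instead of Some 2 *)
  define D :: "proj_line set" where "D = {\<infinity>\<^sub>P, Some 2}"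
  have D: "card D = 2" "0\<^sub>P \<notin> D" "1\<^sub>P \<notin> D" by (auto simp: D_def)
  define KA where "KA = {K \<in> octads. insert 0\<^sub>P D \<subseteq> K \<and> 1\<^sub>P \<notin> K}"
  define KB where "KB = {L \<in> octads. insert 1\<^sub>P D \<subseteq> L \<and> 0\<^sub>P \<notin> L}"
  define \<A> where "\<A> = octad_root ` KA"
  define \<B> where "\<B> = odd_octad_root ` KB"
  have KA: "K \<in> octads" "\<infinity>\<^sub>P \<in> K" "0\<^sub>P \<in> K" "1\<^sub>P \<notin> K" "D \<subseteq> K" if "K \<in> KA" for K
    using that by (auto simp: KA_def D_def)
  have KB: "L \<in> octads" "\<infinity>\<^sub>P \<in> L" "1\<^sub>P \<in> L" "0\<^sub>P \<notin> L" "D \<subseteq> L" if "L \<in> KB" for L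
    using that by (auto simp: KB_def D_def)
  have choose: "(5::nat) choose 2 = 10" by (simp add: choose_two)

  have "card KA = 16" "card KB = 16"
    unfolding KA_def KB_def using D
    by (auto intro!: card_octads_through_avoiding[OF assms] simp del: insert_subset)
  then have card: "card \<A> = 16" "card \<B> = 16"
    using inj_octad_root inj_odd_octad_root
    by (auto simp: \<A>_def \<B>_def card_image inj_on_subset)

  have meets: "meets (octad_root K) (odd_octad_root L) \<longleftrightarrow> card (K \<inter> L) = 4" if "K \<in> KA" for K L
    using meets_octad_root_odd_octad_root[OF assms] KA[OF that] by blast

  have A: "card {b \<in> \<B>. meets (octad_root K) b} = 10" if K: "K \<in> KA" for K
  proof -
    have "{b \<in> \<B>. meets (octad_root K) b} = odd_octad_root ` {L \<in> KB. card (K \<inter> L) = 4}"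
      using meets[OF K] by (auto simp: \<B>_def)
    then have "card {b \<in> \<B>. meets (octad_root K) b} = card {L \<in> KB. card (K \<inter> L) = 4}"
      using inj_odd_octad_root by (simp add: card_image inj_on_subset)
    also have "\<dots> = 10"
      using steiner_card_blocks_meeting_block[OF assms, of K D "0\<^sub>P" "1\<^sub>P"] KA[OF K] D choose
      by (simp add: KB_def conj_ac)
    finally show ?thesis .
  qed

  have B: "card {a \<in> \<A>. meets (odd_octad_root L) a} = 10" if L: "L \<in> KB" for L
  proof -
    have "{a \<in> \<A>. meets (odd_octad_root L) a} = octad_root ` {K \<in> KA. card (L \<inter> K) = 4}"
      using meets by (auto simp: \<A>_def meets_commute[of "odd_octad_root L"] Int_commute)
    then have "card {a \<in> \<A>. meets (odd_octad_root L) a} = card {K \<in> KA. card (L \<inter> K) = 4}"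
      using inj_octad_root by (simp add: card_image inj_on_subset)
    also have "\<dots> = 10"
      using steiner_card_blocks_meeting_block[OF assms, of L D "1\<^sub>P" "0\<^sub>P"] KB[OF L] D choose
      by (simp add: KA_def conj_ac)
    finally show ?thesis .
  qed

  have "\<A> \<noteq> \<B>"
  proof
    assume "\<A> = \<B>"
    moreover obtain K where K: "K \<in> KA" using \<open>card KA = 16\<close> by fastforce
    ultimately obtain L where "octad_root K = odd_octad_root L" unfolding \<A>_def \<B>_def by blast
    (* one vector has even coordinates, the other odd ones; the coordinate at 0 shows it *)
    then have "(2 *\<^sub>R \<nu> K) $ 0\<^sub>P = (\<nu> UNIV - 2 *\<^sub>R \<nu> L + 4 *\<^sub>R \<nu> {\<infinity>\<^sub>P}) $ 0\<^sub>P"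
      by (simp add: octad_root_def odd_octad_root_def)
    then show False using KA[OF K] by (simp add: nu_component split: if_splits)
  qed
  moreover have "\<A> \<subseteq> leech_roots_orth_R octads"
    using octad_root_orth_R[OF assms] KA unfolding \<A>_def by blast
  moreover have "\<B> \<subseteq> leech_roots_orth_R octads"
    using odd_octad_root_orth_R[OF assms] KB unfolding \<B>_def by blast
  moreover have "\<forall>a\<in>\<A>. card {b \<in> \<B>. meets a b} = 10"
    using A by (subst \<A>_def) blast
  moreover have "\<forall>b\<in>\<B>. card {a \<in> \<A>. meets b a} = 10"
    using B by (subst \<B>_def) blast
  ultimately show ?thesis
    using card by blast
qed

end
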